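(* Let $n\geq 3$ and let $A$ be an $n\times n$ complex Hermitian matrix whose off-diagonal entries are either all nonnegative real numbers or all purely imaginary numbers. Let $\lambda_1\leq \lambda_2\leq\cdots\leq\lambda_n$ be the eigenvalues of $A$ and $a_1\leq a_2\leq\cdots\leq a_n$ the diagonal entries of $A$, each listed in increasing order (with multiplicity). Then $$\lambda_2\leq a_3.$$ Moreover, if the off-diagonal entries of $A$ are all purely imaginary, then also $$\lambda_{n-1}\geq a_{n-2}.$$
   Context: A complex number is purely imaginary if its real part is zero (zero counts as purely imaginary). *)

theory Defs
  imports
    "Jordan_Normal_Form.Schur_Decomposition"
    "HOL-Computational_Algebra.Fundamental_Theorem_Algebra"
    "HOL-Library.Nonpos_Ints"
begin

definition hermitian :: "complex mat \<Rightarrow> bool" where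
  "hermitian A \<longleftrightarrow> square_mat A \<and> mat_adjoint A = A"

definition purely_imaginary :: "complex \<Rightarrow> bool" where
  "purely_imaginary z \<longleftrightarrow> Re z = 0"

text \<open>
  The two lists below are meant for Hermitian matrices, whose eigenvalues and diagonal entries are
  real, so that taking real parts is merely the passage from complex to real numbers; see the lemmas
  \<open>eigenvalue_list_hermitian\<close> and \<open>diagonal_list_hermitian\<close>. List positions count
  from 0.
\<close>

definition eigenvalue_list :: "complex mat \<Rightarrow> real list" where
  "eigenvalue_list A = sorted_list_of_multiset (image_mset Re (proots (char_poly A)))"

definition diagonal_list :: "complex mat \<Rightarrow> real list" where
  "diagonal_list A = sort (map Re (diag_mat A))"

lemma hermitian_index:
  assumes "hermitian A" "A \<in> carrier_mat n n" "i < n" "j < n"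
  shows "A $$ (j, i) = cnj (A $$ (i, j))"
proof -
  have "A $$ (j, i) = mat_adjoint A $$ (j, i)"
    using assms by (simp add: hermitian_def)
  also have "\<dots> = cnj (A $$ (i, j))"
    using assms by (simp add: mat_adjoint_def mat_of_rows_def)
  finally show ?thesis .
qed

lemma hermitian_eigenvalue_real:
  assumes h: "hermitian A" and A: "A \<in> carrier_mat n n" and k: "eigenvalue A k"
  shows "k \<in> \<real>"
proof -
  obtain v where v: "v \<in> carrier_vec n" "v \<noteq> 0\<^sub>v n" and Av: "A *\<^sub>v v = k \<cdot>\<^sub>v v"
    using k A by (auto simp: eigenvalue_def eigenvector_def)
  have row: "(\<Sum>j<n. A $$ (i, j) * v $ j) = k * v $ i" if "i < n" for i
  proof -
    have "(A *\<^sub>v v) $ i = (\<Sum>j<n. A $$ (i, j) * v $ j)"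
      using that A v by (simp add: scalar_prod_def lessThan_atLeast0)
    thus ?thesis using that v by (simp add: Av)
  qed
  define N where "N = (\<Sum>i<n. (cmod (v $ i))\<^sup>2)"
  define q where "q = (\<Sum>i<n. \<Sum>j<n. cnj (v $ i) * A $$ (i, j) * v $ j)"
  have "q = (\<Sum>i<n. cnj (v $ i) * (k * v $ i))"
    unfolding q_def by (intro sum.cong refl) (simp add: row[symmetric] sum_distrib_left mult.assoc)
  also have "\<dots> = k * of_real N"
    unfolding N_def of_real_sum sum_distrib_left
    by (intro sum.cong refl) (simp only: complex_norm_square mult_ac)
  finally have q: "q = k * of_real N" .
  have "cnj q = (\<Sum>i<n. \<Sum>j<n. cnj (v $ j) * A $$ (j, i) * v $ i)"
    unfolding q_def cnj_sum
  proof (intro sum.cong refl)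
    fix i j assume "i \<in> {..<n}" "j \<in> {..<n}"
    hence "A $$ (j, i) = cnj (A $$ (i, j))"
      by (intro hermitian_index[OF h A]) auto
    thus "cnj (cnj (v $ i) * A $$ (i, j) * v $ j) = cnj (v $ j) * A $$ (j, i) * v $ i"
      by simp
  qed
  also have "\<dots> = q"
    unfolding q_def by (rule sum.swap)
  finally have "cnj q = q" .
  hence "cnj k * of_real N = k * of_real N"
    by (simp add: q)
  moreover have "N \<noteq> 0"
  proof
    assume "N = 0"
    hence "\<forall>i<n. v $ i = 0"
      by (simp add: N_def sum_nonneg_eq_0_iff)
    hence "v = 0\<^sub>v n" using v by (intro eq_vecI) auto
    thus False using v by simp
  qed
  ultimately show ?thesis
    by (simp add: Reals_cnj_iff)
qed

lemma eigenvalue_list_hermitian: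
  assumes "hermitian A" and A: "A \<in> carrier_mat n n"
  shows "sorted (eigenvalue_list A)" "length (eigenvalue_list A) = n"
    "mset (map complex_of_real (eigenvalue_list A)) = proots (char_poly A)"
    "char_poly A = (\<Prod>x\<leftarrow>eigenvalue_list A. [:- complex_of_real x, 1:])"
proof -
  have monic: "lead_coeff (char_poly A) = 1" and deg: "degree (char_poly A) = n"
    using degree_monic_char_poly[OF A] by auto
  hence nz: "char_poly A \<noteq> 0" by auto
  have m: "mset (eigenvalue_list A) = image_mset Re (proots (char_poly A))"
    by (simp add: eigenvalue_list_def)
  show "sorted (eigenvalue_list A)"
    by (simp add: eigenvalue_list_def)
  have "size (mset (eigenvalue_list A)) = n"
    unfolding m by (simp add: size_proots_complex deg)
  thus "length (eigenvalue_list A) = n" by simp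
  have "image_mset (\<lambda>z. complex_of_real (Re z)) (proots (char_poly A))
      = image_mset (\<lambda>z. z) (proots (char_poly A))"
  proof (rule image_mset_cong)
    fix z assume "z \<in># proots (char_poly A)"
    hence "eigenvalue A z"
      using nz by (simp add: eigenvalue_root_char_poly[OF A])
    hence "z \<in> \<real>" by (rule hermitian_eigenvalue_real[OF assms])
    thus "complex_of_real (Re z) = z" by simp
  qed
  thus ev: "mset (map complex_of_real (eigenvalue_list A)) = proots (char_poly A)"
    by (simp add: m image_mset.compositionality comp_def)
  have "char_poly A = (\<Prod>x\<in>#proots (char_poly A). [:-x, 1:])"
    using complex_poly_decompose_multiset[of "char_poly A"] by (simp add: monic)
  also have "\<dots> = (\<Prod>x\<leftarrow>eigenvalue_list A. [:- complex_of_real x, 1:])"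
    unfolding ev[symmetric] by (simp add: image_mset.compositionality comp_def
      flip: prod_mset_prod_list mset_map)
  finally show "char_poly A = (\<Prod>x\<leftarrow>eigenvalue_list A. [:- complex_of_real x, 1:])" .
qed

lemma diagonal_list_hermitian:
  assumes h: "hermitian A" and A: "A \<in> carrier_mat n n"
  shows "sorted (diagonal_list A)" "length (diagonal_list A) = n"
    "mset (map complex_of_real (diagonal_list A)) = mset (diag_mat A)"
proof -
  show "sorted (diagonal_list A)" "length (diagonal_list A) = n"
    using A by (simp_all add: diagonal_list_def diag_mat_def)
  have "complex_of_real (Re (A $$ (i, i))) = A $$ (i, i)" if "i < n" for i
    using hermitian_index[OF h A that that] by (simp add: complex_eq_iff)
  hence "map (\<lambda>z. complex_of_real (Re z)) (diag_mat A) = diag_mat A"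
    using A by (simp add: diag_mat_def)
  hence "mset (map (\<lambda>z. complex_of_real (Re z)) (diag_mat A)) = mset (diag_mat A)" by simp
  thus "mset (map complex_of_real (diagonal_list A)) = mset (diag_mat A)"
    by (simp add: diagonal_list_def image_mset.compositionality comp_def)
qed

end

theory Submission
  imports Defs "HOL-Combinatorics.Permutations"
begin

text \<open>
  Suppose \<open>\<lambda>\<^sub>2 > t = a\<^sub>3\<close>. By the spectral theorem, \<open>A - t\<close> is positive definite on the hyperplane
  orthogonal to an eigenvector of \<open>\<lambda>\<^sub>1\<close>. Restricted to the three coordinates with smallest diagonal
  entries, it is positive definite on the kernel of a linear form \<open>l\<close> on \<open>\<complex>\<^sup>3\<close>, and stays so when the
  nonpositive diagonal is replaced by zero, giving a matrix \<open>C\<close>. The determinant of the restriction of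
  \<open>C\<close> to the kernel of \<open>l\<close> is, up to a positive factor, the value at \<open>l\<close> of the Hermitian form of
  the adjugate of \<open>C\<close>. In the imaginary case the adjugate is negative semidefinite of rank one. In
  the nonnegative case its diagonal is nonpositive, and evaluating \<open>C\<close> at the vectors of the kernel
  with a zero coordinate bounds the off-diagonal terms by zero. Either way the determinant cannot be
  positive. The second claim is the same argument for \<open>-A\<close>, with an eigenvector of \<open>\<lambda>\<^sub>n\<close>.
\<close>

section \<open>Adjoints of complex matrices\<close>

lemma mat_adjoint_carrier: "A \<in> carrier_mat m n \<Longrightarrow> mat_adjoint A \<in> carrier_mat n m"
  by (auto simp: mat_adjoint_def)

lemma mat_adjoint_index:
  fixes A :: "complex mat"
  assumes "A \<in> carrier_mat m n" "i < n" "j < m"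
  shows "mat_adjoint A $$ (i, j) = cnj (A $$ (j, i))"
  using assms by (simp add: mat_adjoint_def mat_of_rows_def)

lemma mat_adjoint_adjoint: "A \<in> carrier_mat m n \<Longrightarrow> mat_adjoint (mat_adjoint A) = (A :: complex mat)"
  using mat_adjoint_carrier[of A m n] mat_adjoint_carrier[of "mat_adjoint A" n m]
  by (intro eq_matI) (auto simp: mat_adjoint_index[of "mat_adjoint A" n m] mat_adjoint_index[of A m n])

lemma mat_adjoint_mult:
  fixes A B :: "complex mat"
  assumes A: "A \<in> carrier_mat l m" and B: "B \<in> carrier_mat m n"
  shows "mat_adjoint (A * B) = mat_adjoint B * mat_adjoint A"
proof (rule eq_matI)
  have AB: "A * B \<in> carrier_mat l n"
    using A B by simp
  show "dim_row (mat_adjoint (A * B)) = dim_row (mat_adjoint B * mat_adjoint A)"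
    "dim_col (mat_adjoint (A * B)) = dim_col (mat_adjoint B * mat_adjoint A)"
    using A B by (auto simp: mat_adjoint_def)
  fix i j assume "i < dim_row (mat_adjoint B * mat_adjoint A)" "j < dim_col (mat_adjoint B * mat_adjoint A)"
  then have ij: "i < n" "j < l"
    using A B by (auto simp: mat_adjoint_def)
  have "mat_adjoint (A * B) $$ (i, j) = (\<Sum>k<m. cnj (A $$ (j, k) * B $$ (k, i)))"
    using ij A B by (simp add: mat_adjoint_index[OF AB] scalar_prod_def lessThan_atLeast0)
  also have "\<dots> = (\<Sum>k<m. mat_adjoint B $$ (i, k) * mat_adjoint A $$ (k, j))"
    using ij by (intro sum.cong) (auto simp: mat_adjoint_index[OF A] mat_adjoint_index[OF B])
  also have "\<dots> = (mat_adjoint B * mat_adjoint A) $$ (i, j)"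
    using ij carrier_matD[OF mat_adjoint_carrier[OF A]] carrier_matD[OF mat_adjoint_carrier[OF B]]
    by (simp add: scalar_prod_def lessThan_atLeast0)
  finally show "mat_adjoint (A * B) $$ (i, j) = (mat_adjoint B * mat_adjoint A) $$ (i, j)" .
qed

lemma mat_adjoint_four_block:
  fixes A B C D :: "complex mat"
  assumes "A \<in> carrier_mat k m" "B \<in> carrier_mat k n" "C \<in> carrier_mat l m" "D \<in> carrier_mat l n"
  shows "mat_adjoint (four_block_mat A B C D)
    = four_block_mat (mat_adjoint A) (mat_adjoint C) (mat_adjoint B) (mat_adjoint D)"
proof (rule eq_matI)
  note c = assms[THEN mat_adjoint_carrier]
  have F: "four_block_mat A B C D \<in> carrier_mat (k + l) (m + n)"
    using assms by simp
  show dims: "dim_row (mat_adjoint (four_block_mat A B C D)) =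
      dim_row (four_block_mat (mat_adjoint A) (mat_adjoint C) (mat_adjoint B) (mat_adjoint D))"
    "dim_col (mat_adjoint (four_block_mat A B C D)) =
      dim_col (four_block_mat (mat_adjoint A) (mat_adjoint C) (mat_adjoint B) (mat_adjoint D))"
    using carrier_matD[OF mat_adjoint_carrier[OF F]] c by auto
  fix i j
  assume "i < dim_row (four_block_mat (mat_adjoint A) (mat_adjoint C) (mat_adjoint B) (mat_adjoint D))"
    "j < dim_col (four_block_mat (mat_adjoint A) (mat_adjoint C) (mat_adjoint B) (mat_adjoint D))"
  then have ij: "i < m + n" "j < k + l"
    using c by auto
  then show "mat_adjoint (four_block_mat A B C D) $$ (i, j) =
      four_block_mat (mat_adjoint A) (mat_adjoint C) (mat_adjoint B) (mat_adjoint D) $$ (i, j)"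
    using assms c mat_adjoint_index[OF F ij]
    by (auto simp: mat_adjoint_index[OF assms(1)] mat_adjoint_index[OF assms(2)]
        mat_adjoint_index[OF assms(3)] mat_adjoint_index[OF assms(4)])
qed

lemma mat_adjoint_one: "mat_adjoint (1\<^sub>m n) = (1\<^sub>m n :: complex mat)"
  using mat_adjoint_carrier[of "1\<^sub>m n :: complex mat" n n]
  by (intro eq_matI) (auto simp: mat_adjoint_index[of _ n n])

lemma mat_adjoint_zero: "mat_adjoint (0\<^sub>m m n) = (0\<^sub>m n m :: complex mat)"
  using mat_adjoint_carrier[of "0\<^sub>m m n :: complex mat" m n]
  by (intro eq_matI) (auto simp: mat_adjoint_index[of _ m n])

section \<open>The spectral theorem for Hermitian matrices\<close>

text \<open>Complete \<open>v\<close> to a basis; Gram-Schmidt keeps its first vector, and dividing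
  the resulting orthogonal vectors by their norms gives the columns of \<open>W\<close>. The scalar
  \<open>c\<close> is the reciprocal of the norm of \<open>v\<close>.\<close>

lemma unitary_with_first_column:
  fixes v :: "complex vec"
  assumes v: "v \<in> carrier_vec n" and v0: "v \<noteq> 0\<^sub>v n"
  obtains W c where "W \<in> carrier_mat n n" "mat_adjoint W * W = 1\<^sub>m n" "col W 0 = c \<cdot>\<^sub>v v"
proof -
  have n: "n > 0"
    using v v0 by (cases n) (auto)
  define b where "b = basis_completion v"
  define ws where "ws = gram_schmidt n b"
  interpret cof_vec_space n "TYPE(complex)" .
  from basis_completion[OF v v0, folded b_def]
  have dist_b: "distinct b" and indep: "\<not> lin_dep (set b)" and b: "set b \<subseteq> carrier_vec n"
    and hdb: "hd b = v" and len_b: "length b = n" by auto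
  from hdb len_b n obtain vs where bv: "b = v # vs" by (cases b, auto)
  from gram_schmidt_result[OF b dist_b indep refl, folded ws_def]
  have ws: "set ws \<subseteq> carrier_vec n" "corthogonal ws" "length ws = n"
    by (auto simp: len_b)
  from gram_schmidt_hd[OF v, of vs, folded bv] have hdws: "hd ws = v" unfolding ws_def .
  define N where "N i = (\<Sum>k<n. (cmod (ws ! i $ k))\<^sup>2)" for i
  have wsc: "ws ! i \<in> carrier_vec n" if "i < n" for i
    using ws that by (metis nth_mem subsetD)
  have ip: "ws ! i \<bullet>c ws ! j = (\<Sum>k<n. ws ! i $ k * cnj (ws ! j $ k))" if "i < n" "j < n" for i j
    using wsc[OF that(1)] wsc[OF that(2)] by (simp add: scalar_prod_def lessThan_atLeast0)
  have NN: "ws ! i \<bullet>c ws ! i = of_real (N i)" if "i < n" for i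
    unfolding ip[OF that that] N_def of_real_sum by (simp only: complex_norm_square)
  have Npos: "N i > 0" if "i < n" for i
  proof -
    \<comment> \<open>\<open>corthogonal\<close> also asserts that no vector of the list is
      orthogonal to itself.\<close>
    have "N i \<noteq> 0"
      using corthogonalD[OF ws(2), of i i] that ws(3) NN[OF that] by auto
    moreover have "N i \<ge> 0"
      unfolding N_def by (intro sum_nonneg) auto
    ultimately show ?thesis by simp
  qed
  define W where "W = mat n n (\<lambda>(k, i). ws ! i $ k / of_real (sqrt (N i)))"
  have W: "W \<in> carrier_mat n n"
    by (simp add: W_def)
  show thesis
  proof (rule that[OF W])
    show "mat_adjoint W * W = 1\<^sub>m n"
    proof (rule eq_matI)
      fix i j assume "i < dim_row (1\<^sub>m n)" "j < dim_col (1\<^sub>m n)"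
      then have ij: "i < n" "j < n" by auto
      have "(mat_adjoint W * W) $$ (i, j) = (\<Sum>k<n. mat_adjoint W $$ (i, k) * W $$ (k, j))"
        using ij W carrier_matD[OF mat_adjoint_carrier[OF W]]
        by (simp add: scalar_prod_def lessThan_atLeast0)
      also have "\<dots> = (\<Sum>k<n. (ws ! j $ k * cnj (ws ! i $ k)) / of_real (sqrt (N i) * sqrt (N j)))"
        using ij by (intro sum.cong) (simp_all add: mat_adjoint_index[OF W], simp add: W_def)
      also have "\<dots> = (ws ! j \<bullet>c ws ! i) / of_real (sqrt (N i) * sqrt (N j))"
        unfolding ip[OF ij(2,1)] by (simp add: sum_divide_distrib)
      also have "\<dots> = (if i = j then 1 else 0)"
      proof (cases "i = j")
        case True
        then show ?thesis using NN[OF ij(1)] Npos[OF ij(1)] by simp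
      next
        case False
        then show ?thesis using corthogonalD[OF ws(2), of j i] ij ws(3) by simp
      qed
      finally show "(mat_adjoint W * W) $$ (i, j) = 1\<^sub>m n $$ (i, j)"
        using ij by simp
    qed (use W carrier_matD[OF mat_adjoint_carrier[OF W]] in auto)
    have "ws ! 0 = v"
      using hdws ws(3) n by (cases ws) auto
    then show "col W 0 = (1 / of_real (sqrt (N 0))) \<cdot>\<^sub>v v"
      using v n by (intro eq_vecI) (auto simp: W_def)
  qed
qed


text \<open>Deflation, by induction on the list of eigenvalues: a unitary matrix whose first column
  is an eigenvector for \<open>e\<close> splits off a 1 by 1 block, and the remaining Hermitian
  block has the remaining eigenvalues. Splitting them off in the order of \<open>es\<close> also
  fixes their order on the diagonal.\<close>

lemma hermitian_unitary_diagonalization: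
  assumes "hermitian A" "A \<in> carrier_mat n n" "char_poly A = (\<Prod>e\<leftarrow>es. [:- e, 1:])"
  shows "\<exists>U \<in> carrier_mat n n. mat_adjoint U * U = 1\<^sub>m n \<and>
           mat_adjoint U * A * U = mat_diag n (\<lambda>i. es ! i)"
  using assms
proof (induction es arbitrary: n A)
  case Nil
  then have "n = 0"
    using degree_monic_char_poly[of A n] by auto
  with Nil.prems(2) show ?case
    by (intro bexI[of _ "1\<^sub>m 0"]) (auto intro!: eq_matI simp: mat_adjoint_one mat_diag_def)
next
  case (Cons e es n A)
  note A = Cons.prems(2)
  have "degree (char_poly A) = Suc (length es)"
    unfolding Cons.prems(3) by (subst degree_prod_list_eq) (auto simp: o_def sum_list_triv)
  then obtain m where n: "n = Suc m"
    using degree_monic_char_poly[OF A] by auto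
  have "eigenvalue A e"
    unfolding eigenvalue_root_char_poly[OF A] Cons.prems(3) by simp
  then obtain v where v: "v \<in> carrier_vec n" "v \<noteq> 0\<^sub>v n" and Av: "A *\<^sub>v v = e \<cdot>\<^sub>v v"
    using A by (auto simp: eigenvalue_def eigenvector_def)
  obtain W c where W: "W \<in> carrier_mat n n" and unit_W: "mat_adjoint W * W = 1\<^sub>m n"
    and col_W: "col W 0 = c \<cdot>\<^sub>v v"
    using unitary_with_first_column[OF v] .
  note W' = mat_adjoint_carrier[OF W]
  define A' where "A' = mat_adjoint W * A * W"
  have A': "A' \<in> carrier_mat n n"
    using A W W' by (simp add: A'_def)
  have adj_A': "mat_adjoint A' = A'"
    using A W W' Cons.prems(1)
    by (simp add: A'_def hermitian_def mat_adjoint_mult[of _ n n _ n] mat_adjoint_adjoint[OF W])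
  \<comment> \<open>Since \<open>col W 0\<close> is an eigenvector, \<open>A\<close> acts on it as
    \<open>e\<close>, and \<open>mat_adjoint W\<close> takes it back to the first unit
    vector.\<close>
  have "col A' 0 = mat_adjoint W * A *\<^sub>v col W 0"
    using A W W' n unfolding A'_def by (intro col_mult2[of _ n n _ n]) auto
  also have "\<dots> = mat_adjoint W *\<^sub>v (A *\<^sub>v (c \<cdot>\<^sub>v v))"
    using A W W' v unfolding col_W by (intro assoc_mult_mat_vec) auto
  also have "A *\<^sub>v (c \<cdot>\<^sub>v v) = e \<cdot>\<^sub>v col W 0"
    using A v by (simp add: mult_mat_vec Av col_W smult_smult_assoc mult.commute)
  also have "mat_adjoint W *\<^sub>v (e \<cdot>\<^sub>v col W 0) = e \<cdot>\<^sub>v (mat_adjoint W *\<^sub>v col W 0)"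
    using W W' n by (intro mult_mat_vec) (auto intro!: carrier_vecI)
  also have "mat_adjoint W *\<^sub>v col W 0 = col (mat_adjoint W * W) 0"
    using W W' n by (intro col_mult2[symmetric, of _ n n _ n]) auto
  finally have col0: "col A' 0 = e \<cdot>\<^sub>v unit_vec n 0"
    using n by (simp add: unit_W)
  have col0_A': "A' $$ (i, 0) = (if i = 0 then e else 0)" if "i < n" for i
  proof -
    have "A' $$ (i, 0) = col A' 0 $ i"
      using A' that by simp
    then show ?thesis
      using that n by (simp add: col0)
  qed
  \<comment> \<open>Self-adjointness of \<open>A'\<close> carries the zeros of the first column over
    to the first row.\<close>
  have row0_A': "A' $$ (0, i) = (if i = 0 then e else 0)" if "i < n" for i
    using col0_A'[OF that] mat_adjoint_index[OF A', of 0 i] that n by (auto simp: adj_A')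
  define A3 where "A3 = mat m m (\<lambda>(i, j). A' $$ (Suc i, Suc j))"
  have A3: "A3 \<in> carrier_mat m m"
    by (simp add: A3_def)
  define E where "E = mat 1 1 (\<lambda>_. e)"
  have E: "E \<in> carrier_mat 1 1"
    by (simp add: E_def)
  have block: "A' = four_block_mat E (0\<^sub>m 1 m) (0\<^sub>m m 1) A3"
    using A' n by (intro eq_matI) (auto simp: E_def A3_def col0_A' row0_A')
  have "mat_adjoint A3 = A3"
  proof (rule eq_matI)
    fix i j assume "i < dim_row A3" "j < dim_col A3"
    then have ij: "i < m" "j < m" using A3 by auto
    then show "mat_adjoint A3 $$ (i, j) = A3 $$ (i, j)"
      using mat_adjoint_index[OF A', of "Suc i" "Suc j"] n
      by (simp add: mat_adjoint_index[OF A3] adj_A') (simp add: A3_def)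
  qed (use A3 mat_adjoint_carrier[OF A3] in auto)
  then have herm: "hermitian A3"
    using A3 by (simp add: hermitian_def)
  have unit_W': "W * mat_adjoint W = 1\<^sub>m n"
    by (rule mat_mult_left_right_inverse[OF W' W unit_W])
  have "similar_mat A' A"
    using A A' W W' unit_W unit_W' by (intro similar_matI[of _ _ "mat_adjoint W" W n]) (auto simp: A'_def)
  then have "char_poly A = char_poly E * char_poly A3"
    using char_poly_four_block_zeros_col[OF E _ A3, of "0\<^sub>m 1 m"] char_poly_similar[of A' A]
    by (simp add: block)
  also have "char_poly E = [:- e, 1:]"
    using char_poly_upper_triangular[OF E] by (simp add: diag_mat_def E_def upper_triangular_def)
  \<comment> \<open>The common linear factor is cancelled; removing \<open>mult_pCons_left\<close>
    keeps simp from multiplying it out.\<close>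
  finally have "char_poly A3 = (\<Prod>e\<leftarrow>es. [:- e, 1:])"
    using Cons.prems(3) by (simp del: mult_pCons_left)
  from Cons.IH[OF herm A3 this] obtain V where V: "V \<in> carrier_mat m m"
    and unit_V: "mat_adjoint V * V = 1\<^sub>m m" and diag_V: "mat_adjoint V * A3 * V = mat_diag m (\<lambda>i. es ! i)"
    by blast
  note V' = mat_adjoint_carrier[OF V]
  \<comment> \<open>\<open>V\<close> diagonalizes the smaller block; extended by 1 in the first
    coordinate it leaves \<open>e\<close> alone, so \<open>W * X\<close> diagonalizes
    \<open>A\<close>.\<close>
  define X where "X = four_block_mat (1\<^sub>m 1) (0\<^sub>m 1 m) (0\<^sub>m m 1) V"
  have X: "X \<in> carrier_mat n n"
    using V n by (intro carrier_matI) (auto simp: X_def)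
  note X' = mat_adjoint_carrier[OF X]
  have adj_X: "mat_adjoint X = four_block_mat (1\<^sub>m 1) (0\<^sub>m 1 m) (0\<^sub>m m 1) (mat_adjoint V)"
    unfolding X_def using V
    by (simp add: mat_adjoint_four_block[of _ 1 1 _ m _ m] mat_adjoint_one mat_adjoint_zero)
  have mult_X: "four_block_mat F (0\<^sub>m 1 m) (0\<^sub>m m 1) G * four_block_mat F' (0\<^sub>m 1 m) (0\<^sub>m m 1) G'
      = four_block_mat (F * F') (0\<^sub>m 1 m) (0\<^sub>m m 1) (G * G')"
    if "F \<in> carrier_mat 1 1" "F' \<in> carrier_mat 1 1" "G \<in> carrier_mat m m" "G' \<in> carrier_mat m m"
    for F F' G G' :: "complex mat"
    using that by (subst mult_four_block_mat[of _ 1 1 _ m _ m _ _ 1 _ m]) auto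
  have unit_X: "mat_adjoint X * X = 1\<^sub>m n"
  proof -
    have "mat_adjoint X * X = four_block_mat (1\<^sub>m 1 * 1\<^sub>m 1) (0\<^sub>m 1 m) (0\<^sub>m m 1) (mat_adjoint V * V)"
      unfolding adj_X unfolding X_def using V V' by (intro mult_X) auto
    also have "\<dots> = 1\<^sub>m n"
      unfolding unit_V using n by (intro eq_matI) auto
    finally show ?thesis .
  qed
  have diag_X: "mat_adjoint X * A' * X = mat_diag n (\<lambda>i. (e # es) ! i)"
  proof -
    have "mat_adjoint X * A' * X = four_block_mat E (0\<^sub>m 1 m) (0\<^sub>m m 1) (mat_adjoint V * A3 * V)"
      unfolding adj_X block unfolding X_def using V V' A3 E
      by (simp add: mult_X del: One_nat_def)
    also have "\<dots> = mat_diag n (\<lambda>i. (e # es) ! i)"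
      unfolding diag_V using n by (intro eq_matI) (auto simp: E_def mat_diag_def nth_Cons')
    finally show ?thesis .
  qed
  show ?case
  proof (intro bexI conjI)
    show "W * X \<in> carrier_mat n n"
      using W X by simp
    have adj: "mat_adjoint (W * X) = mat_adjoint X * mat_adjoint W"
      by (rule mat_adjoint_mult[OF W X])
    have "mat_adjoint (W * X) * (W * X) = mat_adjoint X * ((mat_adjoint W * W) * X)"
      unfolding adj using W W' X X' by (simp add: assoc_mult_mat[of _ n n _ n _ n])
    then show "mat_adjoint (W * X) * (W * X) = 1\<^sub>m n"
      using X by (simp add: unit_W unit_X)
    have "mat_adjoint (W * X) * A * (W * X) = mat_adjoint X * A' * X"
      unfolding adj A'_def using W W' X X' A by (simp add: assoc_mult_mat[of _ n n _ n _ n])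
    then show "mat_adjoint (W * X) * A * (W * X) = mat_diag n (\<lambda>i. (e # es) ! i)"
      by (simp add: diag_X)
  qed
qed

text \<open>Column \<open>k\<close> of \<open>U\<close> is a unit eigenvector for position
  \<open>k\<close> of the sorted list. Written entrywise, the decomposition lets scaling and
  shifting of \<open>A\<close> act on the coefficients alone. The second property is orthonormality
  of the rows, which yields both the expansion of the identity and Parseval's equation.\<close>

lemma hermitian_spectral_entries:
  assumes h: "hermitian A" and A: "A \<in> carrier_mat n n"
  obtains U :: "nat \<Rightarrow> nat \<Rightarrow> complex" where
    "\<And>i j. i < n \<Longrightarrow> j < n \<Longrightarrow>
       A $$ (i, j) = (\<Sum>k<n. of_real (eigenvalue_list A ! k) * U i k * cnj (U j k))"
    "\<And>i j. i < n \<Longrightarrow> j < n \<Longrightarrow> (\<Sum>k<n. U i k * cnj (U j k)) = (if i = j then 1 else 0)"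
proof -
  define es where "es = map complex_of_real (eigenvalue_list A)"
  have len: "length (eigenvalue_list A) = n"
    by (rule eigenvalue_list_hermitian[OF h A])
  have "char_poly A = (\<Prod>e\<leftarrow>es. [:- e, 1:])"
    using eigenvalue_list_hermitian(4)[OF h A] by (simp add: es_def o_def)
  then obtain V where V: "V \<in> carrier_mat n n" and unit_V: "mat_adjoint V * V = 1\<^sub>m n"
    and diag_V: "mat_adjoint V * A * V = mat_diag n (\<lambda>i. es ! i)"
    using hermitian_unitary_diagonalization[OF h A] by blast
  note V' = mat_adjoint_carrier[OF V]
  have unit_V': "V * mat_adjoint V = 1\<^sub>m n"
    by (rule mat_mult_left_right_inverse[OF V' V unit_V])
  have "V * (mat_adjoint V * A * V) * mat_adjoint V
      = (V * mat_adjoint V) * A * (V * mat_adjoint V)"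
    using V V' A by (simp add: assoc_mult_mat[of _ n n _ n _ n])
  then have A_eq: "A = V * mat_diag n (\<lambda>i. es ! i) * mat_adjoint V"
    using A by (simp add: unit_V' diag_V)
  show thesis
  proof (rule that[of "\<lambda>i k. V $$ (i, k)"])
    fix i j assume ij: "i < n" "j < n"
    have VD: "V * mat_diag n (\<lambda>i. es ! i) = mat n n (\<lambda>(i, k). V $$ (i, k) * es ! k)"
      by (rule mat_diag_mult_right[OF V])
    have "A $$ (i, j) = (mat n n (\<lambda>(i, k). V $$ (i, k) * es ! k) * mat_adjoint V) $$ (i, j)"
      by (subst A_eq) (simp only: VD)
    also have "\<dots> = (\<Sum>k<n. of_real (eigenvalue_list A ! k) * V $$ (i, k) * cnj (V $$ (j, k)))"
      using ij carrier_matD[OF V']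
      by (auto simp: scalar_prod_def lessThan_atLeast0 es_def len mat_adjoint_index[OF V] intro!: sum.cong)
    finally show "A $$ (i, j) = (\<Sum>k<n. of_real (eigenvalue_list A ! k) * V $$ (i, k) * cnj (V $$ (j, k)))" .
    have "(\<Sum>k<n. V $$ (i, k) * cnj (V $$ (j, k))) = (V * mat_adjoint V) $$ (i, j)"
      using ij carrier_matD[OF V'] carrier_matD[OF V]
      by (auto simp: scalar_prod_def lessThan_atLeast0 mat_adjoint_index[OF V] intro!: sum.cong)
    then show "(\<Sum>k<n. V $$ (i, k) * cnj (V $$ (j, k))) = (if i = j then 1 else 0)"
      using ij by (simp add: unit_V')
  qed
qed

section \<open>Hermitian forms in eigenvector coordinates\<close>

text \<open>With the sum over \<open>k\<close> moved outermost, the double sum over \<open>i\<close>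
  and \<open>j\<close> factors into the \<open>k\<close>-th coordinate of \<open>v\<close> times its
  conjugate.\<close>

lemma spectral_form_eq:
  fixes U :: "nat \<Rightarrow> nat \<Rightarrow> complex" and d :: "nat \<Rightarrow> real"
  shows "(\<Sum>i<n. \<Sum>j<n. cnj (v i) * (\<Sum>k<n. of_real (d k) * U i k * cnj (U j k)) * v j)
    = of_real (\<Sum>k<n. d k * (cmod (\<Sum>i<n. cnj (U i k) * v i))\<^sup>2)"
proof -
  have "(\<Sum>i<n. \<Sum>j<n. cnj (v i) * (\<Sum>k<n. of_real (d k) * U i k * cnj (U j k)) * v j)
    = (\<Sum>i<n. \<Sum>j<n. \<Sum>k<n. of_real (d k) * (cnj (v i) * U i k) * (cnj (U j k) * v j))"
    by (simp add: sum_distrib_left sum_distrib_right mult_ac)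
  also have "\<dots> = (\<Sum>i<n. \<Sum>k<n. \<Sum>j<n. of_real (d k) * (cnj (v i) * U i k) * (cnj (U j k) * v j))"
    by (intro sum.cong refl sum.swap)
  also have "\<dots> = (\<Sum>k<n. \<Sum>i<n. \<Sum>j<n. of_real (d k) * (cnj (v i) * U i k) * (cnj (U j k) * v j))"
    by (rule sum.swap)
  also have "\<dots> = (\<Sum>k<n. of_real (d k) * ((\<Sum>i<n. cnj (v i) * U i k) * (\<Sum>j<n. cnj (U j k) * v j)))"
    by (simp only: sum_product) (simp only: sum_distrib_left mult.assoc)
  also have "\<dots> = (\<Sum>k<n. of_real (d k) * ((\<Sum>j<n. cnj (U j k) * v j) * cnj (\<Sum>i<n. cnj (U i k) * v i)))"
    by (simp add: mult.commute)
  also have "\<dots> = of_real (\<Sum>k<n. d k * (cmod (\<Sum>i<n. cnj (U i k) * v i))\<^sup>2)"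
    by (simp only: of_real_sum of_real_mult complex_norm_square)
  finally show ?thesis .
qed

text \<open>The condition \<open>ker\<close> removes the term of index \<open>m\<close>, the only
  one whose coefficient may fail to be positive. By Parseval a nonzero \<open>v\<close> has some
  nonzero coordinate, necessarily at another index.\<close>

lemma spectral_form_pos:
  fixes U :: "nat \<Rightarrow> nat \<Rightarrow> complex" and d :: "nat \<Rightarrow> real"
  assumes orth: "\<And>i j. i < n \<Longrightarrow> j < n \<Longrightarrow> (\<Sum>k<n. U i k * cnj (U j k)) = (if i = j then 1 else 0)"
    and d: "\<And>k. k < n \<Longrightarrow> k \<noteq> m \<Longrightarrow> d k > 0"
    and ker: "(\<Sum>i<n. cnj (U i m) * v i) = 0"
    and nz: "i < n" "v i \<noteq> 0"
  shows "Re (\<Sum>i<n. \<Sum>j<n. cnj (v i) * (\<Sum>k<n. of_real (d k) * U i k * cnj (U j k)) * v j) > 0"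
proof -
  define c where "c k = (\<Sum>i<n. cnj (U i k) * v i)" for k
  \<comment> \<open>Parseval is the case of all coefficients 1, where row orthonormality turns the
    matrix into the identity.\<close>
  have "complex_of_real (\<Sum>k<n. 1 * (cmod (c k))\<^sup>2)
      = (\<Sum>i<n. \<Sum>j<n. cnj (v i) * (\<Sum>k<n. of_real 1 * U i k * cnj (U j k)) * v j)"
    unfolding c_def by (rule spectral_form_eq[symmetric])
  also have "\<dots> = (\<Sum>i<n. \<Sum>j<n. if i = j then cnj (v i) * v j else 0)"
    by (intro sum.cong refl) (simp add: orth)
  also have "\<dots> = of_real (\<Sum>i<n. (cmod (v i))\<^sup>2)"
    unfolding of_real_sum complex_norm_square by (intro sum.cong) (simp_all add: mult.commute)
  finally have parseval: "(\<Sum>k<n. (cmod (c k))\<^sup>2) = (\<Sum>i<n. (cmod (v i))\<^sup>2)"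
    unfolding of_real_eq_iff by simp
  also have "\<dots> > 0"
    using nz by (intro sum_pos2[of _ i]) auto
  finally obtain k where k: "k < n" "c k \<noteq> 0"
    by (metis (mono_tags, lifting) lessThan_iff less_irrefl norm_zero sum.neutral zero_power2)
  then have "k \<noteq> m"
    using ker by (auto simp: c_def)
  have "(\<Sum>k<n. d k * (cmod (c k))\<^sup>2) > 0"
  proof (rule sum_pos2[of _ k])
    show "0 < d k * (cmod (c k))\<^sup>2"
      using d[of k] k \<open>k \<noteq> m\<close> by simp
    show "0 \<le> d j * (cmod (c j))\<^sup>2" if "j \<in> {..<n}" for j
      using d[of j] that ker by (cases "j = m") (auto simp: c_def less_imp_le)
  qed (use k in auto)
  then show ?thesis
    unfolding spectral_form_eq c_def by simp
qed

section \<open>Hermitian forms with three small diagonal entries\<close>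

text \<open>The real part is half the form of the Hermitian 3 by 3 matrix with zero diagonal and
  entries \<open>x\<close>, \<open>y\<close>, \<open>z\<close> above it. Were it positive on the
  plane, the 2 by 2 matrix of its restriction would have positive determinant, and so the adjugate
  form \<open>g\<close> would be positive; in both cases \<open>g\<close> is at most 0.\<close>

lemma hermitian_form_3_nonpos_on_plane:
  fixes x y z l1 l2 l3 :: complex
  assumes entries: "x \<in> \<real>\<^sub>\<ge>\<^sub>0 \<and> y \<in> \<real>\<^sub>\<ge>\<^sub>0 \<and> z \<in> \<real>\<^sub>\<ge>\<^sub>0 \<or> Re x = 0 \<and> Re y = 0 \<and> Re z = 0"
  shows "\<exists>a b c. (a, b, c) \<noteq> (0, 0, 0) \<and> l1 * a + l2 * b + l3 * c = 0 \<and>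
           Re (x * cnj a * b + y * cnj a * c + z * cnj b * c) \<le> 0"
proof (rule ccontr)
  assume neg: "\<not> ?thesis"
  have pos: "0 < Re (x * cnj a * b + y * cnj a * c + z * cnj b * c)"
    if "a \<noteq> 0 \<or> b \<noteq> 0 \<or> c \<noteq> 0" "l1 * a + l2 * b + l3 * c = 0" for a b c
  proof (rule ccontr)
    assume "\<not> ?thesis"
    then show False using neg that by (metis linorder_not_le prod.inject)
  qed
  \<comment> \<open>Otherwise a unit vector would lie in the plane, where the form vanishes because
    of the zero diagonal.\<close>
  have l3: "l3 \<noteq> 0"
    using pos[of 0 0 1] by auto
  have l1: "l1 \<noteq> 0"
    using pos[of 1 0 0] by auto
  \<comment> \<open>The matrix of twice the form in the parametrisation \<open>(a * l3, b * l3, - a * l1 - b * l2)\<close> of the plane.\<close>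
  define m11 where "m11 = - 2 * Re (y * cnj l3 * l1)"
  define m22 where "m22 = - 2 * Re (z * cnj l3 * l2)"
  define m12 where "m12 = x * (l3 * cnj l3) - y * cnj l3 * l2 - cnj z * l3 * cnj l1"
  \<comment> \<open>The next three facts evaluate the form at the vectors of the plane with a zero
    coordinate. The first two give the diagonal of the 2 by 2 matrix; all three serve in the
    nonnegative case.\<close>
  have p11: "m11 > 0"
    using pos[of l3 0 "- l1"] l3 by (simp add: m11_def algebra_simps)
  have p22: "m22 > 0"
    using pos[of 0 l3 "- l2"] l3 by (simp add: m22_def algebra_simps)
  have p12: "Re (x * cnj l2 * l1) < 0"
    using pos[of l2 "- l1" 0] l1 by (simp add: algebra_simps)
  have form: "Re (x * cnj (a * l3) * (b * l3) + y * cnj (a * l3) * (- a * l1 - b * l2)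
      + z * cnj (b * l3) * (- a * l1 - b * l2))
    = (m11 * (cmod a)\<^sup>2 + m22 * (cmod b)\<^sup>2) / 2 + Re (m12 * cnj a * b)" for a b
    unfolding m11_def m22_def m12_def cmod_power2 by (simp add: power2_eq_square field_simps)
  \<comment> \<open>The parameters \<open>a = - m12\<close>, \<open>b = m11\<close> are annihilated
    by the first row of the 2 by 2 matrix, so the form there is its determinant times
    \<open>m11 / 2\<close>.\<close>
  have "0 < (m11 * (cmod (- m12))\<^sup>2 + m22 * (cmod (complex_of_real m11))\<^sup>2) / 2
      + Re (m12 * cnj (- m12) * of_real m11)"
    unfolding form[symmetric] using p11 l3 by (intro pos) (auto simp: algebra_simps)
  also have "\<dots> = m11 * (m11 * m22 - (Re m12)\<^sup>2 - (Im m12)\<^sup>2) / 2"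
    unfolding cmod_power2 by (simp add: power2_eq_square field_simps)
  finally have det: "m11 * m22 - (Re m12)\<^sup>2 - (Im m12)\<^sup>2 > 0"
    using p11 by (simp add: zero_less_mult_iff)
  \<comment> \<open>\<open>g\<close> is the Hermitian form of the adjugate at \<open>(l1, l2, l3)\<close>.\<close>
  define g where "g = 2 * Re (x * cnj y * l3 * cnj l2 + x * z * cnj l3 * l1 + y * cnj z * l1 * cnj l2)
     - (cmod z)\<^sup>2 * (cmod l1)\<^sup>2 - (cmod y)\<^sup>2 * (cmod l2)\<^sup>2 - (cmod x)\<^sup>2 * (cmod l3)\<^sup>2"
  have "m11 * m22 - (Re m12)\<^sup>2 - (Im m12)\<^sup>2 = (cmod l3)\<^sup>2 * g"
    unfolding m11_def m22_def m12_def g_def cmod_power2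
    by (simp add: power2_eq_square algebra_simps)
  with det have g: "g > 0"
    by (simp add: zero_less_mult_iff)
  from entries show False
  proof
    assume "x \<in> \<real>\<^sub>\<ge>\<^sub>0 \<and> y \<in> \<real>\<^sub>\<ge>\<^sub>0 \<and> z \<in> \<real>\<^sub>\<ge>\<^sub>0"
    then obtain p q r where real: "x = of_real p" "y = of_real q" "z = of_real r" "p \<ge> 0" "q \<ge> 0" "r \<ge> 0"
      by (auto simp: nonneg_Reals_def)
    have "p * Re (cnj l2 * l1) < 0" "q * Re (cnj l3 * l1) < 0" "r * Re (cnj l3 * l2) < 0"
      using p12 p11 p22 by (simp_all add: m11_def m22_def real algebra_simps)
    \<comment> \<open>Each product just found is negative with a nonnegative first factor, so its
      real part is negative. Multiplied by the other two entries, these real parts are the cross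
      terms of \<open>g\<close>.\<close>
    then have "q * r * Re (cnj l2 * l1) \<le> 0" "p * r * Re (cnj l3 * l1) \<le> 0" "p * q * Re (cnj l3 * l2) \<le> 0"
      using real(4-) by (simp_all add: mult_less_0_iff mult_nonneg_nonpos)
    moreover have "Re (x * cnj y * l3 * cnj l2 + x * z * cnj l3 * l1 + y * cnj z * l1 * cnj l2)
      = q * r * Re (cnj l2 * l1) + p * r * Re (cnj l3 * l1) + p * q * Re (cnj l3 * l2)"
      by (simp add: real algebra_simps)
    moreover have "(cmod z)\<^sup>2 * (cmod l1)\<^sup>2 \<ge> 0" "(cmod y)\<^sup>2 * (cmod l2)\<^sup>2 \<ge> 0" "(cmod x)\<^sup>2 * (cmod l3)\<^sup>2 \<ge> 0"
      by simp_all
    ultimately show False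
      using g unfolding g_def by linarith
  next
    assume "Re x = 0 \<and> Re y = 0 \<and> Re z = 0"
    \<comment> \<open>The matrix is i times a real skew-symmetric one, whose adjugate is the outer
      square of its kernel vector \<open>(Im z, - Im y, Im x)\<close>. The square of i supplies the
      minus sign.\<close>
    then have "g = - (cmod (Im x * l3 - Im y * l2 + Im z * l1))\<^sup>2"
      unfolding g_def cmod_power2 by (simp add: power2_eq_square algebra_simps)
    then show False
      using g by simp
  qed
qed

lemma sum_supported_on_3:
  fixes f :: "nat \<Rightarrow> 'a :: comm_monoid_add"
  assumes "p < n" "q < n" "r < n" "p \<noteq> q" "p \<noteq> r" "q \<noteq> r"
    and "\<And>i. i \<noteq> p \<Longrightarrow> i \<noteq> q \<Longrightarrow> i \<noteq> r \<Longrightarrow> f i = 0"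
  shows "(\<Sum>i<n. f i) = f p + f q + f r"
proof -
  have "(\<Sum>i<n. f i) = (\<Sum>i\<in>{p, q, r}. f i)"
    using assms by (intro sum.mono_neutral_right) auto
  then show ?thesis
    using assms by (simp add: add.assoc)
qed

text \<open>A vector supported on \<open>p\<close>, \<open>q\<close>, \<open>r\<close> reduces the
  claim to three variables. Its diagonal terms are nonpositive, so the statement for zero diagonal
  suffices.\<close>

lemma hermitian_form_nonpos_on_hyperplane:
  fixes H :: "nat \<Rightarrow> nat \<Rightarrow> complex" and l :: "nat \<Rightarrow> complex"
  assumes H: "\<And>i j. i < n \<Longrightarrow> j < n \<Longrightarrow> H j i = cnj (H i j)"
    and entries: "(\<forall>i<n. \<forall>j<n. i \<noteq> j \<longrightarrow> H i j \<in> \<real>\<^sub>\<ge>\<^sub>0) \<or> (\<forall>i<n. \<forall>j<n. i \<noteq> j \<longrightarrow> Re (H i j) = 0)"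
    and pqr: "p < n" "q < n" "r < n" "p \<noteq> q" "p \<noteq> r" "q \<noteq> r"
    and diag: "Re (H p p) \<le> 0" "Re (H q q) \<le> 0" "Re (H r r) \<le> 0"
  shows "\<exists>v. (\<exists>i<n. v i \<noteq> 0) \<and> (\<Sum>i<n. l i * v i) = 0 \<and>
           Re (\<Sum>i<n. \<Sum>j<n. cnj (v i) * H i j * v j) \<le> 0"
proof -
  have "H p q \<in> \<real>\<^sub>\<ge>\<^sub>0 \<and> H p r \<in> \<real>\<^sub>\<ge>\<^sub>0 \<and> H q r \<in> \<real>\<^sub>\<ge>\<^sub>0 \<or> Re (H p q) = 0 \<and> Re (H p r) = 0 \<and> Re (H q r) = 0"
    using entries pqr by blast
  from hermitian_form_3_nonpos_on_plane[OF this, of "l p" "l q" "l r"]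
  obtain a b c where nz: "(a, b, c) \<noteq> (0, 0, 0)" and ker: "l p * a + l q * b + l r * c = 0"
    and le: "Re (H p q * cnj a * b + H p r * cnj a * c + H q r * cnj b * c) \<le> 0"
    by blast
  define v where "v i = (if i = p then a else if i = q then b else if i = r then c else 0)" for i
  have v: "v p = a" "v q = b" "v r = c"
    using pqr by (auto simp: v_def)
  have v0: "v i = 0" if "i \<noteq> p" "i \<noteq> q" "i \<noteq> r" for i
    using that by (simp add: v_def)
  have "\<exists>i<n. v i \<noteq> 0"
    using nz pqr v by auto
  moreover have "(\<Sum>i<n. l i * v i) = 0"
    using ker by (simp add: sum_supported_on_3[OF pqr] v0 v)
  moreover have "Re (\<Sum>i<n. \<Sum>j<n. cnj (v i) * H i j * v j) \<le> 0"
  proof -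
    have im: "Im (H p p) = 0" "Im (H q q) = 0" "Im (H r r) = 0"
      using H[of p p] H[of q q] H[of r r] pqr by (simp_all add: complex_eq_iff)
    have "Re (\<Sum>i<n. \<Sum>j<n. cnj (v i) * H i j * v j)
      = Re (H p p) * (cmod a)\<^sup>2 + Re (H q q) * (cmod b)\<^sup>2 + Re (H r r) * (cmod c)\<^sup>2
        + 2 * Re (H p q * cnj a * b + H p r * cnj a * c + H q r * cnj b * c)"
      using H[of p q] H[of p r] H[of q r] pqr im unfolding cmod_power2
      by (simp add: sum_supported_on_3[OF pqr] v0 v algebra_simps power2_eq_square)
    moreover have "Re (H p p) * (cmod a)\<^sup>2 \<le> 0" "Re (H q q) * (cmod b)\<^sup>2 \<le> 0" "Re (H r r) * (cmod c)\<^sup>2 \<le> 0"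
      using diag by (simp_all add: mult_nonpos_nonneg)
    ultimately show ?thesis
      using le by linarith
  qed
  ultimately show ?thesis by blast
qed

section \<open>Ordered eigenvalues against ordered diagonal entries\<close>

text \<open>\<open>p\<close> sends a position in the sorted diagonal to a matrix index. Injectivity
  provides three distinct indices for the three smallest or the three largest entries, even when
  values repeat.\<close>

lemma diagonal_list_permutation:
  assumes A: "A \<in> carrier_mat n n"
  obtains p where "inj_on p {..<n}" "\<And>i. i < n \<Longrightarrow> p i < n"
    "\<And>i. i < n \<Longrightarrow> diagonal_list A ! i = Re (A $$ (p i, p i))"
proof -
  have "mset (diagonal_list A) = mset (map Re (diag_mat A))"
    by (simp add: diagonal_list_def)
  then obtain p where p: "p permutes {..<length (map Re (diag_mat A))}"
    and eq: "permute_list p (map Re (diag_mat A)) = diagonal_list A"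
    by (rule mset_eq_permutation)
  have len: "length (map Re (diag_mat A)) = n"
    using A by (simp add: diag_mat_def)
  have pn: "p i < n" if "i < n" for i
    using permutes_in_image[OF p, of i] that len by simp
  show thesis
  proof (rule that)
    show "inj_on p {..<n}"
      using permutes_inj_on[OF p] .
    show "diagonal_list A ! i = Re (A $$ (p i, p i))" if "i < n" for i
    proof -
      have "diagonal_list A ! i = map Re (diag_mat A) ! p i"
        unfolding eq[symmetric] using that len by (intro permute_list_nth[OF p]) simp
      then show ?thesis
        using A pn[OF that] by (simp add: diag_mat_def)
    qed
  qed (rule pn)
qed


theorem theorem1:
  fixes n :: nat and A :: "complex mat"
  assumes "n \<ge> 3"
    and "A \<in> carrier_mat n n"
    and "hermitian A"
    and "(\<forall>i<n. \<forall>j<n. i \<noteq> j \<longrightarrow> A $$ (i, j) \<in> \<real>\<^sub>\<ge>\<^sub>0) \<or>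
         (\<forall>i<n. \<forall>j<n. i \<noteq> j \<longrightarrow> purely_imaginary (A $$ (i, j)))"
  shows "eigenvalue_list A ! 1 \<le> diagonal_list A ! 2 \<and>
         ((\<forall>i<n. \<forall>j<n. i \<noteq> j \<longrightarrow> purely_imaginary (A $$ (i, j))) \<longrightarrow>
           eigenvalue_list A ! (n - 2) \<ge> diagonal_list A ! (n - 3))"
proof (intro conjI impI)
  note A = \<open>A \<in> carrier_mat n n\<close> and h = \<open>hermitian A\<close>
  obtain p where inj: "inj_on p {..<n}" and p: "\<And>i. i < n \<Longrightarrow> p i < n"
    and diag: "\<And>i. i < n \<Longrightarrow> diagonal_list A ! i = Re (A $$ (p i, p i))"
    using diagonal_list_permutation[OF A] by blast
  have p_neq: "p i \<noteq> p j" if "i < n" "j < n" "i \<noteq> j" for i j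
    using inj that by (auto simp: inj_on_def)
  have sorted_d: "diagonal_list A ! i \<le> diagonal_list A ! j" if "i \<le> j" "j < n" for i j
    using diagonal_list_hermitian[OF h A] that by (auto intro: sorted_nth_mono)
  have sorted_e: "eigenvalue_list A ! i \<le> eigenvalue_list A ! j" if "i \<le> j" "j < n" for i j
    using eigenvalue_list_hermitian[OF h A] that by (auto intro: sorted_nth_mono)
  obtain U where U: "\<And>i j. i < n \<Longrightarrow> j < n \<Longrightarrow>
       A $$ (i, j) = (\<Sum>k<n. of_real (eigenvalue_list A ! k) * U i k * cnj (U j k))"
    and orth: "\<And>i j. i < n \<Longrightarrow> j < n \<Longrightarrow> (\<Sum>k<n. U i k * cnj (U j k)) = (if i = j then 1 else 0)"
    using hermitian_spectral_entries[OF h A] by blast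
  \<comment> \<open>Row orthonormality expands the identity in the same eigenvectors, so
    \<open>s\<close> times \<open>A\<close> minus \<open>t\<close> has coefficients
    \<open>s * (eigenvalue_list A ! k - t)\<close>.\<close>
  have shifted: "(\<Sum>k<n. of_real (s * (eigenvalue_list A ! k - t)) * U i k * cnj (U j k))
      = of_real s * (A $$ (i, j) - (if i = j then of_real t else 0))"
    if "i < n" "j < n" for i j and s t :: real
  proof -
    have "(\<Sum>k<n. of_real (s * (eigenvalue_list A ! k - t)) * U i k * cnj (U j k))
      = of_real s * ((\<Sum>k<n. of_real (eigenvalue_list A ! k) * U i k * cnj (U j k))
          - of_real t * (\<Sum>k<n. U i k * cnj (U j k)))"
      by (simp add: sum_distrib_left sum_subtractf algebra_simps)
    then show ?thesis
      using that by (simp add: U[symmetric] orth)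
  qed
  \<comment> \<open>Common core of both claims: \<open>s\<close> is the sign 1 or -1,
    \<open>t\<close> the diagonal entry compared with, and \<open>m\<close> the position of the one
    exempt eigenvalue. Positivity on the hyperplane orthogonal to eigenvector \<open>m\<close>
    contradicts the three small diagonal entries.\<close>
  have no_gap: False
    if gap: "\<And>k. k < n \<Longrightarrow> k \<noteq> m \<Longrightarrow> s * (eigenvalue_list A ! k - t) > 0"
      and entries: "(\<forall>i<n. \<forall>j<n. i \<noteq> j \<longrightarrow> of_real s * A $$ (i, j) \<in> \<real>\<^sub>\<ge>\<^sub>0) \<or>
        (\<forall>i<n. \<forall>j<n. i \<noteq> j \<longrightarrow> Re (of_real s * A $$ (i, j)) = 0)"
      and three: "a < n" "b < n" "c < n" "a \<noteq> b" "a \<noteq> c" "b \<noteq> c"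
      and small: "s * (Re (A $$ (a, a)) - t) \<le> 0" "s * (Re (A $$ (b, b)) - t) \<le> 0"
        "s * (Re (A $$ (c, c)) - t) \<le> 0"
    for m a b c and s t :: real
  proof -
    define H where "H i j = (\<Sum>k<n. of_real (s * (eigenvalue_list A ! k - t)) * U i k * cnj (U j k))" for i j
    have H_eq: "H i j = of_real s * (A $$ (i, j) - (if i = j then of_real t else 0))"
      if "i < n" "j < n" for i j
      unfolding H_def using that by (rule shifted)
    have "H j i = cnj (H i j)" for i j
      by (simp add: H_def mult_ac)
    moreover have "(\<forall>i<n. \<forall>j<n. i \<noteq> j \<longrightarrow> H i j \<in> \<real>\<^sub>\<ge>\<^sub>0) \<or> (\<forall>i<n. \<forall>j<n. i \<noteq> j \<longrightarrow> Re (H i j) = 0)"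
      using entries by (simp add: H_eq)
    moreover have "Re (H a a) \<le> 0" "Re (H b b) \<le> 0" "Re (H c c) \<le> 0"
      using small three by (simp_all add: H_eq)
    ultimately obtain v i where v: "i < n" "v i \<noteq> 0" "(\<Sum>i<n. cnj (U i m) * v i) = 0"
      and le: "Re (\<Sum>i<n. \<Sum>j<n. cnj (v i) * H i j * v j) \<le> 0"
      using hermitian_form_nonpos_on_hyperplane[of n H a b c "\<lambda>i. cnj (U i m)"] three by blast
    have "Re (\<Sum>i<n. \<Sum>j<n. cnj (v i) * H i j * v j) > 0"
      unfolding H_def using orth gap v by (intro spectral_form_pos[where m = m and i = i]) auto
    with le show False by simp
  qed
  show "eigenvalue_list A ! 1 \<le> diagonal_list A ! 2"
  proof (rule ccontr)
    assume neg: "\<not> ?thesis"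
    show False
    \<comment> \<open>Counting from 0, the exempt position 0 is \<lambda>_1, and the threshold at
      position 2 is a_3. By sortedness every eigenvalue from position 1 on exceeds it.\<close>
    proof (rule no_gap[of 0 1 "diagonal_list A ! 2" "p 0" "p 1" "p 2"])
      show "1 * (eigenvalue_list A ! k - diagonal_list A ! 2) > 0" if "k < n" "k \<noteq> 0" for k
        using sorted_e[of 1 k] that neg by simp
      show "(\<forall>i<n. \<forall>j<n. i \<noteq> j \<longrightarrow> of_real 1 * A $$ (i, j) \<in> \<real>\<^sub>\<ge>\<^sub>0) \<or>
        (\<forall>i<n. \<forall>j<n. i \<noteq> j \<longrightarrow> Re (of_real 1 * A $$ (i, j)) = 0)"
        using assms(4) by (simp add: purely_imaginary_def)
    qed (use \<open>n \<ge> 3\<close> p p_neq sorted_d[of 0 2] sorted_d[of 1 2] diag[of 0] diag[of 1] diag[of 2] in auto)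
  qed
  assume imag: "\<forall>i<n. \<forall>j<n. i \<noteq> j \<longrightarrow> purely_imaginary (A $$ (i, j))"
  show "eigenvalue_list A ! (n - 2) \<ge> diagonal_list A ! (n - 3)"
  proof (rule ccontr)
    assume neg: "\<not> ?thesis"
    \<comment> \<open>Subtraction on naturals is truncated; these positions are distinct because
      \<open>n \<ge> 3\<close>.\<close>
    have idx: "n - 3 < n" "n - 2 < n" "n - 1 < n" "n - 3 \<noteq> n - 2" "n - 3 \<noteq> n - 1" "n - 2 \<noteq> n - 1"
      "n - 3 \<le> n - 2" "n - 3 \<le> n - 1"
      using \<open>n \<ge> 3\<close> by linarith+
    have large: "- 1 * (Re (A $$ (p i, p i)) - diagonal_list A ! (n - 3)) \<le> 0"
      if "n - 3 \<le> i" "i < n" for i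
      using sorted_d[OF that] diag[OF that(2)] by simp
    show False
    \<comment> \<open>Here \<lambda>_n is exempt and the threshold is a_(n-2). The sign -1 preserves
      purely imaginary entries, whereas it would spoil nonnegative ones.\<close>
    proof (rule no_gap[of "n - 1" "- 1" "diagonal_list A ! (n - 3)" "p (n - 3)" "p (n - 2)" "p (n - 1)"])
      show "- 1 * (eigenvalue_list A ! k - diagonal_list A ! (n - 3)) > 0" if "k < n" "k \<noteq> n - 1" for k
      proof -
        have "k \<le> n - 2" "n - 2 < n"
          using that \<open>n \<ge> 3\<close> by linarith+
        then show ?thesis
          using sorted_e[of k "n - 2"] neg by simp
      qed
      show "(\<forall>i<n. \<forall>j<n. i \<noteq> j \<longrightarrow> of_real (- 1) * A $$ (i, j) \<in> \<real>\<^sub>\<ge>\<^sub>0) \<or>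
        (\<forall>i<n. \<forall>j<n. i \<noteq> j \<longrightarrow> Re (of_real (- 1) * A $$ (i, j)) = 0)"
        using imag by (simp add: purely_imaginary_def)
    qed (fact p[OF idx(1)] p[OF idx(2)] p[OF idx(3)] p_neq[OF idx(1,2,4)] p_neq[OF idx(1,3,5)]
          p_neq[OF idx(2,3,6)] large[OF order_refl idx(1)] large[OF idx(7,2)] large[OF idx(8,3)])+
  qed
qed

end
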